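(* Let $p\ge 2$ be a real number and let $f:(0,\infty)\to(0,\infty)$ be a $p$-integrable function (i.e. $f$ is measurable and $\int_0^\infty f(x)^p\,dx<\infty$). Then $$\begin{aligned} \int_{0}^{\infty}\left(\frac{1}{x}\int_{0}^{x}f(t)\,dt\right)^p dx &\le\left(\frac{p}{p-1}\right)^p\int_{0}^{\infty}f(x)^p\,dx\\ &\quad-\left(\frac{p}{p-1}\right)^{p-2}\int_{0}^{\infty}\frac{1}{x}\int_{0}^{x}x^{\frac{1}{p}}t^{-\frac{1}{p}}\left|x^{-\frac{1}{p}}t^{\frac{1}{p}}f(t)-\frac{p-1}{p}\,\frac{1}{x}\int_{0}^{x}f(r)\,dr\right|^p dt\,dx . \end{aligned}$$
   Context: All integrals are with respect to Lebesgue measure. *)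

theory Defs
  imports "HOL-Analysis.Analysis"
begin

text \<open>
  The Bochner integral of a non-integrable function is \<open>0\<close>. An inequality between integrals
  is therefore meaningful only together with the integrability of the integrands, which is why
  the theorem also asserts that every integral occurring in it exists.
\<close>

definition hardy_mean :: "(real \<Rightarrow> real) \<Rightarrow> real \<Rightarrow> real" where
  "hardy_mean f x = 1 / x * (LINT t:{0<..<x}|lebesgue. f t)"

definition hardy_remainder_integrand :: "real \<Rightarrow> (real \<Rightarrow> real) \<Rightarrow> real \<Rightarrow> real \<Rightarrow> real" where
  "hardy_remainder_integrand p f x t =
     x powr (1 / p) * t powr (- 1 / p) *
     \<bar>x powr (- 1 / p) * t powr (1 / p) * f t - (p - 1) / p * hardy_mean f x\<bar> powr p"

definition hardy_remainder :: "real \<Rightarrow> (real \<Rightarrow> real) \<Rightarrow> real \<Rightarrow> real" where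
  "hardy_remainder p f x =
     1 / x * (LINT t:{0<..<x}|lebesgue. hardy_remainder_integrand p f x t)"

end

theory Submission
  imports Defs
begin

text \<open>
  Write \<open>H\<close> for the Hardy mean of \<open>f\<close>, \<open>R\<close> for the remainder and \<open>q = p / (p - 1)\<close>. For \<open>p \<ge> 2\<close>
  the map \<open>u \<mapsto> u\<^sup>p\<close> is superquadratic: \<open>u\<^sup>p \<ge> m\<^sup>p + p m\<^bsup>p-1\<^esup> (u - m) + \<bar>u - m\<bar>\<^sup>p\<close>
  for \<open>u, m \<ge> 0\<close>. Take \<open>u = (t/x)\<^bsup>1/p\<^esup> f(t)\<close> and \<open>m = H(x)/q\<close>, and integrate against
  the measure \<open>(1/x) (x/t)\<^bsup>1/p\<^esup> dt\<close> on \<open>(0, x)\<close>. Its total mass is \<open>q\<close> and the integral of \<open>u\<close> is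
  \<open>H(x)\<close>, so the linear term vanishes and
  \<open>q\<^bsup>1-p\<^esup> H(x)\<^sup>p + R(x) \<le> (1/x) \<integral>\<^sub>0\<^sup>x (t/x)\<^bsup>1-1/p\<^esup> f(t)\<^sup>p dt\<close>. By Tonelli the right-hand side
  integrates over \<open>x\<close> to \<open>q \<integral> f\<^sup>p\<close>. Multiplying by \<open>q\<^bsup>p-1\<^esup>\<close> gives the claim, even with the larger
  constant \<open>q\<^bsup>p-1\<^esup>\<close> in front of the remainder.
\<close>

section \<open>Superquadraticity of real powers\<close>

text \<open>In \<open>c powr s = c * c powr (s - 1)\<close> the second factor is monotone in
  \<open>c\<close>, because \<open>s - 1 >= 0\<close>, so it can be raised to
  \<open>(a + b) powr (s - 1)\<close> in both terms.\<close>

lemma powr_superadditive: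
  fixes a b s :: real
  assumes "0 \<le> a" "0 \<le> b" "1 \<le> s"
  shows "a powr s + b powr s \<le> (a + b) powr s"
proof -
  have *: "c powr s = c * c powr (s - 1)" if "0 \<le> c" for c :: real
    using that by (cases "c = 0") (auto simp: powr_diff)
  have "a powr s + b powr s = a * a powr (s - 1) + b * b powr (s - 1)"
    using * assms by simp
  also have "\<dots> \<le> a * (a + b) powr (s - 1) + b * (a + b) powr (s - 1)"
    using assms by (intro add_mono mult_left_mono powr_mono2) auto
  also have "\<dots> = (a + b) powr s"
    using *[of "a + b"] assms by (simp add: distrib_right)
  finally show ?thesis .
qed

text \<open>As a function of the distance \<open>d\<close> between \<open>u\<close> and
  \<open>m\<close>, the gap \<open>h\<close> between the two sides vanishes at 0. Its derivative is
  \<open>p\<close> times a defect of superadditivity for the exponent \<open>p - 1\<close>, which is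
  at least 1 as \<open>p >= 2\<close>, so the gap only grows.\<close>

lemma powr_superquadratic:
  fixes u m p :: real
  assumes u: "0 \<le> u" and m: "0 \<le> m" and p: "2 \<le> p"
  shows "m powr p + p * m powr (p - 1) * (u - m) + \<bar>u - m\<bar> powr p \<le> u powr p"
proof (cases "m \<le> u")
  case True
  define h where "h d = (m + d) powr p - m powr p - p * m powr (p - 1) * d - d powr p" for d
  have "h 0 \<le> h (u - m)"
  \<comment> \<open>A power with base 0 occurs at \<open>d = 0\<close>, so the derivative is taken
    only in the open interval, with mere continuity at the ends.\<close>
  proof (rule DERIV_nonneg_imp_increasing_open[where f = h])
    show "continuous_on {0..u - m} h"
      unfolding h_def using p m by (intro continuous_intros continuous_on_powr') auto
    fix d assume d: "0 < d" "d < u - m"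
    have "(h has_real_derivative p * ((m + d) powr (p - 1) - m powr (p - 1) - d powr (p - 1))) (at d)"
      unfolding h_def using d m by (auto intro!: derivative_eq_intros simp: algebra_simps)
    moreover have "0 \<le> p * ((m + d) powr (p - 1) - m powr (p - 1) - d powr (p - 1))"
      using powr_superadditive[of m d "p - 1"] d m p by (intro mult_nonneg_nonneg) auto
    ultimately show "\<exists>y. (h has_real_derivative y) (at d) \<and> 0 \<le> y" by blast
  qed (use True in simp)
  then show ?thesis using True by (simp add: h_def)
next
  case False
  define h where "h d = (m - d) powr p - m powr p + p * m powr (p - 1) * d - d powr p" for d
  have "h 0 \<le> h (m - u)"
  proof (rule DERIV_nonneg_imp_increasing_open[where f = h])
    show "continuous_on {0..m - u} h"
      unfolding h_def using p m u by (intro continuous_intros continuous_on_powr') auto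
    fix d assume d: "0 < d" "d < m - u"
    have "(h has_real_derivative p * (m powr (p - 1) - (m - d) powr (p - 1) - d powr (p - 1))) (at d)"
      unfolding h_def using d u by (auto intro!: derivative_eq_intros simp: algebra_simps)
    moreover have "0 \<le> p * (m powr (p - 1) - (m - d) powr (p - 1) - d powr (p - 1))"
      using powr_superadditive[of "m - d" d "p - 1"] d u p by (intro mult_nonneg_nonneg) auto
    ultimately show "\<exists>y. (h has_real_derivative y) (at d) \<and> 0 \<le> y" by blast
  qed (use False in simp)
  then show ?thesis using False by (simp add: h_def algebra_simps)
qed

section \<open>Set integrals with respect to Lebesgue measure\<close>

lemma set_borel_measurable_lebesgue:
  fixes f :: "'a::euclidean_space \<Rightarrow> real"
  assumes "f \<in> borel_measurable borel" "A \<in> sets borel"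
  shows "set_borel_measurable lebesgue A f"
  unfolding set_borel_measurable_def using assms
  by (intro measurable_completion) (auto intro!: borel_measurable_indicator borel_measurable_scaleR)

text \<open>Altering a function on a negligible set preserves integrability. Hence either both sides
  equal their gauge integrals, which agree, or both are the default value 0.\<close>

lemma set_lebesgue_integral_spike:
  fixes f g :: "'a::euclidean_space \<Rightarrow> real"
  assumes N: "negligible N" and eq: "\<And>t. t \<in> A - N \<Longrightarrow> f t = g t"
  shows "(LINT t:A|lebesgue. f t) = (LINT t:A|lebesgue. g t)"
proof -
  have iff: "set_integrable lebesgue A g \<longleftrightarrow> set_integrable lebesgue A f"
    by (rule absolutely_integrable_spike_eq[OF N]) (rule eq)
  show ?thesis
  proof (cases "set_integrable lebesgue A f")
    case True
    have "integral A f = integral A g"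
      by (rule integral_spike[OF N]) (simp add: eq)
    then show ?thesis using True iff by (simp add: set_lebesgue_integral_eq_integral)
  next
    case False
    then show ?thesis using iff
      by (simp add: set_integrable_def set_lebesgue_integral_def not_integrable_integral_eq)
  qed
qed

lemma set_integral_powr_from_0:
  fixes a x :: real
  assumes "- 1 < a" "0 \<le> x"
  shows "set_integrable lebesgue {0<..<x} (\<lambda>t. t powr a)"
    and "(LINT t:{0<..<x}|lebesgue. t powr a) = x powr (a + 1) / (a + 1)"
proof -
  have "((\<lambda>t. t powr a) has_integral (x powr (a + 1) / (a + 1))) {0<..<x}"
    using has_integral_powr_from_0[OF assms] has_integral_Icc_iff_Ioo by blast
  moreover from this show "set_integrable lebesgue {0<..<x} (\<lambda>t. t powr a)"
    by (intro nonnegative_absolutely_integrable_1) auto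
  ultimately show "(LINT t:{0<..<x}|lebesgue. t powr a) = x powr (a + 1) / (a + 1)"
    by (simp add: set_lebesgue_integral_eq_integral integral_unique)
qed

text \<open>Evaluates the inner integral, over \<open>x > t\<close>, once the order of integration
  is exchanged.\<close>

lemma set_integral_powr_to_inf:
  fixes a x :: real
  assumes "a < - 1" "0 < x"
  shows "set_integrable lebesgue {x<..} (\<lambda>t. t powr a)"
    and "(LINT t:{x<..}|lebesgue. t powr a) = - (x powr (a + 1)) / (a + 1)"
proof -
  have "((\<lambda>t. t powr a) has_integral - (x powr (a + 1)) / (a + 1)) {x<..}"
    using has_integral_powr_to_inf[OF assms]
    by (rule iffD1[OF has_integral_spike_set_eq, rotated 2])
      (auto intro: negligible_subset[of "{x}"])
  moreover from this show "set_integrable lebesgue {x<..} (\<lambda>t. t powr a)"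
    by (intro nonnegative_absolutely_integrable_1) auto
  ultimately show "(LINT t:{x<..}|lebesgue. t powr a) = - (x powr (a + 1)) / (a + 1)"
    by (simp add: set_lebesgue_integral_eq_integral integral_unique)
qed

lemma set_lebesgue_integral_nonneg:
  fixes f :: "'a \<Rightarrow> real"
  assumes "\<And>t. t \<in> A \<Longrightarrow> 0 \<le> f t"
  shows "0 \<le> (LINT t:A|M. f t)"
  unfolding set_lebesgue_integral_def
  using assms by (intro Bochner_Integration.integral_nonneg) (auto simp: indicator_def)

section \<open>Integrals over initial intervals and exchange of the order of integration\<close>

text \<open>With the upper limit \<open>x\<close> moved into the integrand, the domain no longer
  depends on \<open>x\<close>, and measurability of parameter integrals over \<open>lborel\<close>
  applies.\<close>

lemma borel_measurable_set_integral_initial: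
  fixes F :: "real \<Rightarrow> real \<Rightarrow> real"
  assumes [measurable]: "(\<lambda>(x, t). F x t) \<in> borel_measurable (borel \<Otimes>\<^sub>M borel)"
  shows "(\<lambda>x. LINT t:{0<..<x}|lebesgue. F x t) \<in> borel_measurable borel"
proof -
  have [measurable]: "(\<lambda>(x, t). F x t) \<in> borel_measurable (borel \<Otimes>\<^sub>M lborel)"
    using assms by (simp cong: measurable_cong_sets sets_pair_measure_cong)
  have "(LINT t:{0<..<x}|lebesgue. F x t) = (LINT t|lborel. (if 0 < t \<and> t < x then F x t else 0))" for x
    unfolding set_lebesgue_integral_def
    by (subst integral_completion) (auto intro!: Bochner_Integration.integral_cong simp: indicator_def)
  then show ?thesis by simp
qed

text \<open>Fubini on the triangle \<open>0 < t < x\<close>: for fixed \<open>t\<close> the integral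
  of \<open>x powr (- 1 - a)\<close> over \<open>x > t\<close> is \<open>t powr (- a) / a\<close>,
  which cancels \<open>t powr a\<close>. It is applied with \<open>a = 1 - 1 / p\<close>, where
  \<open>1 / a = p / (p - 1)\<close>.\<close>

lemma averaging_kernel_integral:
  fixes h :: "real \<Rightarrow> real"
  assumes h: "h \<in> borel_measurable borel" and int: "set_integrable lebesgue {0<..} h"
    and a: "0 < a"
  shows "set_integrable lebesgue {0<..} (\<lambda>x. x powr (- 1 - a) * (LINT t:{0<..<x}|lebesgue. t powr a * h t))"
    and "(LINT x:{0<..}|lebesgue. x powr (- 1 - a) * (LINT t:{0<..<x}|lebesgue. t powr a * h t))
      = (LINT t:{0<..}|lebesgue. h t) / a"
proof -
  note [measurable] = h
  define k where "k t x = (if 0 < t \<and> t < x then x powr (- 1 - a) * (t powr a * h t) else 0)" for t x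
  have [measurable]: "(\<lambda>(t, x). k t x) \<in> borel_measurable (lborel \<Otimes>\<^sub>M lborel)"
    unfolding k_def by measurable
  \<comment> \<open>Borel functions have the same integrals over \<open>lebesgue\<close> and
    \<open>lborel\<close>; Fubini is then used on the product of \<open>lborel\<close> with
    itself.\<close>
  have lb: "set_integrable lebesgue A u \<longleftrightarrow> integrable lborel (\<lambda>x. indicator A x * u x)"
    "(LINT x:A|lebesgue. u x) = (LINT x|lborel. indicator A x * u x)"
    if [measurable]: "u \<in> borel_measurable borel" "A \<in> sets borel" for u :: "real \<Rightarrow> real" and A
    unfolding set_integrable_def set_lebesgue_integral_def
    by (simp_all add: integrable_completion integral_completion)
  \<comment> \<open>The third claim concerns absolute values because \<open>h\<close> may change
    sign and Fubini asks for absolute integrability.\<close>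
  have inner: "integrable lborel (k t)" "(LINT x|lborel. k t x) = indicator {0<..} t * h t / a"
    "(LINT x|lborel. \<bar>k t x\<bar>) = indicator {0<..} t * \<bar>h t\<bar> / a" for t
  proof -
    consider "t \<le> 0" | "0 < t" by linarith
    then have "integrable lborel (k t) \<and> (LINT x|lborel. k t x) = indicator {0<..} t * h t / a
      \<and> (LINT x|lborel. \<bar>k t x\<bar>) = indicator {0<..} t * \<bar>h t\<bar> / a"
    proof cases
      case 1
      then have "k t = (\<lambda>_. 0)" by (auto simp: k_def)
      then show ?thesis using 1 by simp
    next
      case 2
      let ?w = "\<lambda>x. indicator {t<..} x * x powr (- 1 - a)"
      have w: "integrable lborel ?w" "(LINT x|lborel. ?w x) = t powr (- a) / a"
        using set_integral_powr_to_inf[of "- 1 - a" t] 2 a by (simp_all add: lb)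
      have "k t = (\<lambda>x. ?w x * (t powr a * h t))"
        "(\<lambda>x. \<bar>k t x\<bar>) = (\<lambda>x. ?w x * (t powr a * \<bar>h t\<bar>))"
        using 2 by (auto simp: k_def fun_eq_iff abs_mult)
      moreover have "t powr (- a) * t powr a = 1"
        using 2 by (simp flip: powr_add)
      ultimately show ?thesis using w 2 by (simp add: field_simps)
    qed
    then show "integrable lborel (k t)" "(LINT x|lborel. k t x) = indicator {0<..} t * h t / a"
      "(LINT x|lborel. \<bar>k t x\<bar>) = indicator {0<..} t * \<bar>h t\<bar> / a" by auto
  qed
  have h_int: "integrable lborel (\<lambda>t. indicator {0<..} t * h t)"
    using int by (simp add: lb)
  then have h_int': "integrable lborel (\<lambda>t. indicator {0<..} t * \<bar>h t\<bar>)"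
    using integrable_abs[OF h_int] by (simp add: abs_mult)
  have int2: "integrable (lborel \<Otimes>\<^sub>M lborel) (\<lambda>(t, x). k t x)"
    by (rule lborel_pair.Fubini_integrable) (use inner h_int' in auto)
  have outer: "indicator {0<..} x * (x powr (- 1 - a) * (LINT t:{0<..<x}|lebesgue. t powr a * h t)) = (LINT t|lborel. k t x)" for x
  proof -
    have "(LINT t|lborel. k t x) = (LINT t|lborel. x powr (- 1 - a) * (indicator {0<..<x} t * (t powr a * h t)))"
      by (intro Bochner_Integration.integral_cong) (auto simp: k_def)
    also have "\<dots> = x powr (- 1 - a) * (LINT t:{0<..<x}|lebesgue. t powr a * h t)"
      by (simp add: lb)
    finally show ?thesis by (cases "0 < x") (auto simp: set_lebesgue_integral_def)
  qed
  have meas: "(\<lambda>x. x powr (- 1 - a) * (LINT t:{0<..<x}|lebesgue. t powr a * h t)) \<in> borel_measurable borel"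
    by (intro borel_measurable_times borel_measurable_set_integral_initial) measurable
  show "set_integrable lebesgue {0<..} (\<lambda>x. x powr (- 1 - a) * (LINT t:{0<..<x}|lebesgue. t powr a * h t))"
    using lborel_pair.integrable_snd[OF int2] unfolding lb(1)[OF meas borel_open[OF open_greaterThan]] outer .
  show "(LINT x:{0<..}|lebesgue. x powr (- 1 - a) * (LINT t:{0<..<x}|lebesgue. t powr a * h t))
      = (LINT t:{0<..}|lebesgue. h t) / a"
    using lborel_pair.Fubini_integral[OF int2] unfolding lb(2)[OF meas borel_open[OF open_greaterThan]] outer
    by (simp add: lb inner)
qed

section \<open>The inequality for nonnegative Borel functions\<close>

context
  fixes p :: real and g :: "real \<Rightarrow> real"
  assumes p: "2 \<le> p" and g [measurable]: "g \<in> borel_measurable borel" and g_nonneg: "\<And>t. 0 \<le> g t"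
    and g_int: "set_integrable lebesgue {0<..} (\<lambda>t. g t powr p)"
begin

lemma set_integrable_powr_initial: "set_integrable lebesgue {0<..<x} (\<lambda>t. g t powr p)"
  by (rule set_integrable_subset[OF g_int]) auto

text \<open>Pointwise \<open>g\<close> is at most \<open>1 + g powr p\<close>, and constants are
  integrable on a bounded interval.\<close>

lemma set_integrable_initial:
  assumes "0 < x"
  shows "set_integrable lebesgue {0<..<x} g"
proof (rule set_integrable_bound)
  \<comment> \<open>On positive \<open>t\<close> the term \<open>t powr 0\<close> is the constant 1,
    written as a power to fit \<open>set_integral_powr_from_0\<close>.\<close>
  show "set_integrable lebesgue {0<..<x} (\<lambda>t. t powr 0 + g t powr p)"
    by (intro set_integral_add set_integral_powr_from_0 set_integrable_powr_initial) (use assms in auto)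
  have "g t \<le> 1 + g t powr p" for t
  proof (cases "g t \<le> 1")
    case False
    then have "g t powr 1 \<le> g t powr p" using p by (intro powr_mono) auto
    then show ?thesis using False by simp
  qed (simp add: add_increasing2)
  then show "AE t in lebesgue. t \<in> {0<..<x} \<longrightarrow> norm (g t) \<le> norm (t powr 0 + g t powr p)"
    using g_nonneg by (auto simp: abs_of_nonneg add_nonneg_nonneg)
qed (intro set_borel_measurable_lebesgue, auto)

lemma hardy_mean_nonneg:
  assumes "0 < x"
  shows "0 \<le> hardy_mean g x"
  unfolding hardy_mean_def using assms set_lebesgue_integral_nonneg[of "{0<..<x}" g lebesgue] g_nonneg
  by simp

text \<open>Superquadraticity multiplied by the weight \<open>w\<close>. Since
  \<open>w * u = g t\<close>, the bound is a combination of three functions of \<open>t\<close>,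
  each integrable on the initial interval, with coefficients depending on \<open>x\<close>
  alone.\<close>

lemma hardy_remainder_integrand_bound:
  assumes x: "0 < x" and t: "0 < t"
  shows "hardy_remainder_integrand p g x t
    \<le> x powr (1 / p - 1) * (t powr (1 - 1 / p) * g t powr p)
      - ((p - 1) / p * hardy_mean g x) powr p * (x powr (1 / p) * t powr (- 1 / p))
      - p * ((p - 1) / p * hardy_mean g x) powr (p - 1)
        * (g t - (p - 1) / p * hardy_mean g x * (x powr (1 / p) * t powr (- 1 / p)))"
proof -
  define m where "m = (p - 1) / p * hardy_mean g x"
  define w where "w = x powr (1 / p) * t powr (- 1 / p)"
  define u where "u = x powr (- 1 / p) * t powr (1 / p) * g t"
  have m: "0 \<le> m" unfolding m_def using p hardy_mean_nonneg[OF x] by (intro mult_nonneg_nonneg) auto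
  have u: "0 \<le> u" unfolding u_def using g_nonneg by simp
  have w: "0 \<le> w" unfolding w_def by simp
  have wu: "w * u = g t"
    unfolding w_def u_def using x t by (simp add: powr_minus field_simps)
  have "u powr p = x powr (- 1) * t powr 1 * g t powr p"
    unfolding u_def using x t g_nonneg p by (simp add: powr_mult powr_powr)
  then have wup: "w * u powr p = x powr (1 / p - 1) * (t powr (1 - 1 / p) * g t powr p)"
    unfolding w_def using x t by (simp add: powr_diff powr_minus field_simps)
  have "\<bar>u - m\<bar> powr p \<le> u powr p - m powr p - p * m powr (p - 1) * (u - m)"
    using powr_superquadratic[OF u m p] by linarith
  then have "w * \<bar>u - m\<bar> powr p \<le> w * (u powr p - m powr p - p * m powr (p - 1) * (u - m))"
    using w by (rule mult_left_mono)
  also have "\<dots> = w * u powr p - m powr p * w - p * m powr (p - 1) * (w * u - m * w)"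
    by (simp add: algebra_simps)
  finally show ?thesis
    unfolding wu wup unfolding hardy_remainder_integrand_def m_def w_def u_def .
qed

lemma hardy_remainder_bound:
  assumes x: "0 < x"
  shows "set_integrable lebesgue {0<..<x} (hardy_remainder_integrand p g x)"
    and "(p / (p - 1)) powr (1 - p) * hardy_mean g x powr p + hardy_remainder p g x
      \<le> x powr (- 1 - (1 - 1 / p)) * (LINT t:{0<..<x}|lebesgue. t powr (1 - 1 / p) * g t powr p)"
proof -
  define H where "H = hardy_mean g x"
  define q where "q = p / (p - 1)"
  define m where "m = (p - 1) / p * H"
  define w where "w = (\<lambda>t. x powr (1 / p) * t powr (- 1 / p))"
  define U where "U = (\<lambda>t. t powr (1 - 1 / p) * g t powr p)"
  let ?B = "\<lambda>t. x powr (1 / p - 1) * U t - m powr p * w t - p * m powr (p - 1) * (g t - m * w t)"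
  have q: "0 < q" "m = H / q" unfolding q_def m_def using p by auto
  have H: "0 \<le> H" unfolding H_def by (rule hardy_mean_nonneg[OF x])
  have iw: "set_integrable lebesgue {0<..<x} w"
    unfolding w_def using p x
    by (intro set_integrable_mult_right set_integral_powr_from_0) (auto simp: field_simps)
  have "(LINT t:{0<..<x}|lebesgue. w t) = x powr (1 / p) * (x powr (- 1 / p + 1) / (- 1 / p + 1))"
    unfolding w_def using p x
    by (subst set_integral_mult_right, subst set_integral_powr_from_0(2)) (auto simp: field_simps)
  also have "\<dots> = (x powr (1 / p) * x powr (- 1 / p + 1)) * (1 / (- 1 / p + 1))"
    by simp
  also have "x powr (1 / p) * x powr (- 1 / p + 1) = x"
    using x by (simp flip: powr_add)
  also have "1 / (- 1 / p + 1) = q"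
    unfolding q_def using p by (simp add: field_simps)
  finally have Iw: "(LINT t:{0<..<x}|lebesgue. w t) = x * q" .
  have iU: "set_integrable lebesgue {0<..<x} U"
  proof (rule set_integrable_bound)
    show "set_integrable lebesgue {0<..<x} (\<lambda>t. x powr (1 - 1 / p) * g t powr p)"
      by (intro set_integrable_mult_right set_integrable_powr_initial)
    show "set_borel_measurable lebesgue {0<..<x} U"
      unfolding U_def by (intro set_borel_measurable_lebesgue) auto
    show "AE t in lebesgue. t \<in> {0<..<x} \<longrightarrow> norm (U t) \<le> norm (x powr (1 - 1 / p) * g t powr p)"
      unfolding U_def using p by (auto intro!: mult_right_mono powr_mono2)
  qed
  have ig: "set_integrable lebesgue {0<..<x} g" by (rule set_integrable_initial[OF x])
  have Ig: "(LINT t:{0<..<x}|lebesgue. g t) = x * H"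
    unfolding H_def hardy_mean_def using x by simp
  have iB: "set_integrable lebesgue {0<..<x} ?B"
    by (intro set_integral_diff set_integrable_mult_right iw iU ig)
  have IB: "(LINT t:{0<..<x}|lebesgue. ?B t) = x powr (1 / p - 1) * (LINT t:{0<..<x}|lebesgue. U t)
    - m powr p * (x * q) - p * m powr (p - 1) * (x * H - m * (x * q))"
    by (simp add: set_integral_diff set_integrable_mult_right iw iU ig Iw Ig)
  have le: "hardy_remainder_integrand p g x t \<le> ?B t" if "t \<in> {0<..<x}" for t
    using hardy_remainder_integrand_bound[OF x, of t] that unfolding U_def m_def w_def H_def by simp
  \<comment> \<open>The remainder integrand is nonnegative, so the one-sided bound \<open>le\<close>
    already dominates it in norm.\<close>
  have "norm (hardy_remainder_integrand p g x t) \<le> norm (?B t)" if "t \<in> {0<..<x}" for t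
  proof -
    have "0 \<le> hardy_remainder_integrand p g x t" by (simp add: hardy_remainder_integrand_def)
    then show ?thesis using le[OF that] by simp
  qed
  then show int: "set_integrable lebesgue {0<..<x} (hardy_remainder_integrand p g x)"
    unfolding hardy_remainder_integrand_def
    by (intro set_integrable_bound[OF iB] set_borel_measurable_lebesgue) (auto simp: hardy_remainder_integrand_def)
  \<comment> \<open>The factor \<open>(p - 1) / p\<close> in the remainder integrand is exactly what
    makes the linear term integrate to 0.\<close>
  have "x * H - m * (x * q) = 0" using q by simp
  moreover have "(LINT t:{0<..<x}|lebesgue. hardy_remainder_integrand p g x t) \<le> (LINT t:{0<..<x}|lebesgue. ?B t)"
    by (rule set_integral_mono[OF int iB le])
  ultimately have "(LINT t:{0<..<x}|lebesgue. hardy_remainder_integrand p g x t)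
      \<le> x powr (1 / p - 1) * (LINT t:{0<..<x}|lebesgue. U t) - m powr p * (x * q)"
    unfolding IB by (simp only: mult_zero_right diff_zero)
  then have "hardy_remainder p g x \<le> 1 / x * (x powr (1 / p - 1) * (LINT t:{0<..<x}|lebesgue. U t) - m powr p * (x * q))"
    unfolding hardy_remainder_def using x by (intro mult_left_mono) auto
  also have "\<dots> = (1 / x * x powr (1 / p - 1)) * (LINT t:{0<..<x}|lebesgue. U t) - m powr p * q"
    using x by (simp add: field_simps)
  \<comment> \<open>The exponent is brought to the shape \<open>- 1 - a\<close> of
    \<open>averaging_kernel_integral\<close>.\<close>
  also have "1 / x * x powr (1 / p - 1) = x powr (- 1 - (1 - 1 / p))"
    using x by (simp add: powr_diff powr_minus field_simps power2_eq_square)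
  also have "m powr p * q = q powr (1 - p) * H powr p"
    unfolding q(2) using q(1) H by (simp add: powr_divide powr_diff)
  finally show "(p / (p - 1)) powr (1 - p) * hardy_mean g x powr p + hardy_remainder p g x
      \<le> x powr (- 1 - (1 - 1 / p)) * (LINT t:{0<..<x}|lebesgue. t powr (1 - 1 / p) * g t powr p)"
    unfolding q_def H_def U_def by simp
qed

lemma borel_measurable_hardy_mean [measurable]: "hardy_mean g \<in> borel_measurable borel"
proof -
  have [measurable]: "(\<lambda>x. LINT t:{0<..<x}|lebesgue. g t) \<in> borel_measurable borel"
    by (rule borel_measurable_set_integral_initial) measurable
  show ?thesis unfolding hardy_mean_def by measurable
qed

lemma borel_measurable_hardy_remainder: "hardy_remainder p g \<in> borel_measurable borel"
proof -
  have [measurable]: "(\<lambda>x. LINT t:{0<..<x}|lebesgue. hardy_remainder_integrand p g x t) \<in> borel_measurable borel"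
    unfolding hardy_remainder_integrand_def
    by (rule borel_measurable_set_integral_initial) measurable
  show ?thesis unfolding hardy_remainder_def by measurable
qed

text \<open>The mean term and the remainder are both nonnegative with sum at most \<open>K\<close>,
  so \<open>K\<close> dominates each of them. This gives both integrability claims before the bound
  itself is integrated.\<close>

lemma hardy_inequality_borel:
  shows "set_integrable lebesgue {0<..} (\<lambda>x. hardy_mean g x powr p)"
    and "set_integrable lebesgue {0<..} (hardy_remainder p g)"
    and "(LINT x:{0<..}|lebesgue. hardy_mean g x powr p)
      \<le> (p / (p - 1)) powr p * (LINT x:{0<..}|lebesgue. g x powr p)
        - (p / (p - 1)) powr (p - 2) * (LINT x:{0<..}|lebesgue. hardy_remainder p g x)"
proof -
  define q where "q = p / (p - 1)"
  define K where "K = (\<lambda>x. x powr (- 1 - (1 - 1 / p)) * (LINT t:{0<..<x}|lebesgue. t powr (1 - 1 / p) * g t powr p))"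
  have q: "1 \<le> q" unfolding q_def using p by simp
  have a: "0 < 1 - 1 / p" using p by simp
  have K: "set_integrable lebesgue {0<..} K"
    "(LINT x:{0<..}|lebesgue. K x) = q * (LINT x:{0<..}|lebesgue. g x powr p)"
  proof -
    have "1 / (1 - 1 / p) = q" unfolding q_def using p by (simp add: field_simps)
    then show "set_integrable lebesgue {0<..} K"
      "(LINT x:{0<..}|lebesgue. K x) = q * (LINT x:{0<..}|lebesgue. g x powr p)"
      using averaging_kernel_integral[OF _ g_int a] unfolding K_def by (auto simp: field_simps)
  qed
  have R0: "0 \<le> hardy_remainder p g x" if "0 < x" for x
    unfolding hardy_remainder_def hardy_remainder_integrand_def using that
    by (intro mult_nonneg_nonneg set_lebesgue_integral_nonneg) auto
  have le: "q powr (1 - p) * hardy_mean g x powr p + hardy_remainder p g x \<le> K x" if "0 < x" for x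
    using hardy_remainder_bound(2)[OF that] unfolding q_def K_def .
  show iR: "set_integrable lebesgue {0<..} (hardy_remainder p g)"
  proof (rule set_integrable_bound[OF K(1)])
    have "norm (hardy_remainder p g x) \<le> norm (K x)" if "0 < x" for x
    proof -
      have "0 \<le> q powr (1 - p) * hardy_mean g x powr p" by simp
      then show ?thesis using le[OF that] R0[OF that] unfolding real_norm_def by linarith
    qed
    then show "AE x in lebesgue. x \<in> {0<..} \<longrightarrow> norm (hardy_remainder p g x) \<le> norm (K x)" by auto
  qed (intro set_borel_measurable_lebesgue borel_measurable_hardy_remainder, simp)
  have iH': "set_integrable lebesgue {0<..} (\<lambda>x. q powr (1 - p) * hardy_mean g x powr p)"
  proof (rule set_integrable_bound[OF K(1)])
    have "norm (q powr (1 - p) * hardy_mean g x powr p) \<le> norm (K x)" if "0 < x" for x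
      using le[OF that] R0[OF that] by simp
    then show "AE x in lebesgue. x \<in> {0<..} \<longrightarrow> norm (q powr (1 - p) * hardy_mean g x powr p) \<le> norm (K x)" by auto
  qed (intro set_borel_measurable_lebesgue, auto)
  then show iH: "set_integrable lebesgue {0<..} (\<lambda>x. hardy_mean g x powr p)"
    using q by simp
  let ?IH = "LINT x:{0<..}|lebesgue. hardy_mean g x powr p"
  let ?IR = "LINT x:{0<..}|lebesgue. hardy_remainder p g x"
  let ?Ig = "LINT x:{0<..}|lebesgue. g x powr p"
  have "q powr (1 - p) * ?IH + ?IR
      = (LINT x:{0<..}|lebesgue. q powr (1 - p) * hardy_mean g x powr p + hardy_remainder p g x)"
    by (simp add: set_integral_add iH' iR)
  also have "\<dots> \<le> (LINT x:{0<..}|lebesgue. K x)"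
    using le by (intro set_integral_mono set_integral_add iH' iR K) auto
  finally have "q powr (p - 1) * (q powr (1 - p) * ?IH + ?IR) \<le> q powr (p - 1) * (q * ?Ig)"
    unfolding K by (rule mult_left_mono) simp
  moreover have "q powr (p - 1) * q powr (1 - p) = 1" "q powr (p - 1) * q = q powr p"
    using q by (simp_all add: powr_diff)
  ultimately have "?IH + q powr (p - 1) * ?IR \<le> q powr p * ?Ig"
    by (simp add: distrib_left flip: mult.assoc)
  \<comment> \<open>The constant is lowered to the stated one, using \<open>q >= 1\<close> and the
    nonnegativity of the remainder.\<close>
  moreover have "q powr (p - 2) * ?IR \<le> q powr (p - 1) * ?IR"
    using q R0 by (intro mult_right_mono powr_mono set_lebesgue_integral_nonneg) auto
  ultimately show "?IH \<le> (p / (p - 1)) powr p * ?Ig - (p / (p - 1)) powr (p - 2) * ?IR"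
    unfolding q_def by linarith
qed

end

section \<open>Reduction of the Lebesgue measurable case to the Borel case\<close>

text \<open>
  Tonelli needs product measurability, which Lebesgue measurability of \<open>f\<close> does not provide;
  hence the passage to a Borel representative.
\<close>

lemma lebesgue_ex_borel_nonneg:
  fixes f :: "real \<Rightarrow> real"
  assumes f: "set_borel_measurable lebesgue A f" and nonneg: "\<And>t. t \<in> A \<Longrightarrow> 0 \<le> f t"
  obtains g N where "g \<in> borel_measurable borel" "\<And>t. 0 \<le> g t" "negligible N"
    "\<And>t. t \<in> A - N \<Longrightarrow> f t = g t"
proof -
  obtain g where g [measurable]: "g \<in> borel_measurable borel"
    and eq: "AE t in lborel. indicator A t *\<^sub>R f t = g t"
    using completion_ex_borel_measurable_real[OF f[unfolded set_borel_measurable_def]] by auto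
  obtain N where N: "N \<in> null_sets lebesgue" "\<And>t. t \<notin> N \<Longrightarrow> indicator A t *\<^sub>R f t = g t"
    using AE_E3[OF AE_completion[OF eq]] by auto
  \<comment> \<open>Truncation at 0 makes the representative nonnegative everywhere and keeps its
    values on \<open>A - N\<close>, where it equals \<open>f\<close>.\<close>
  have "f t = max 0 (g t)" if "t \<in> A - N" for t
    using that nonneg[of t] N(2)[of t] by auto
  with N(1) show ?thesis
    by (intro that[of "\<lambda>t. max 0 (g t)" N]) (auto simp: negligible_iff_null_sets)
qed

theorem corollary3p3:
  fixes p :: real and f :: "real \<Rightarrow> real"
  assumes "p \<ge> 2"
    and "\<And>x. x > 0 \<Longrightarrow> f x > 0"
    and "set_borel_measurable lebesgue {0<..} f"
    and "set_integrable lebesgue {0<..} (\<lambda>x. f x powr p)"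
  shows "(\<forall>x>0. set_integrable lebesgue {0<..<x} f) \<and>
    (\<forall>x>0. set_integrable lebesgue {0<..<x} (hardy_remainder_integrand p f x)) \<and>
    set_integrable lebesgue {0<..} (\<lambda>x. hardy_mean f x powr p) \<and>
    set_integrable lebesgue {0<..} (hardy_remainder p f) \<and>
    (LINT x:{0<..}|lebesgue. hardy_mean f x powr p)
      \<le> (p / (p - 1)) powr p * (LINT x:{0<..}|lebesgue. f x powr p)
        - (p / (p - 1)) powr (p - 2) * (LINT x:{0<..}|lebesgue. hardy_remainder p f x)"
proof -
  have nonneg: "0 \<le> f t" if "t \<in> {0<..}" for t
    using assms(2)[of t] that by simp
  obtain g N where g: "g \<in> borel_measurable borel" "\<And>t. 0 \<le> g t" and N: "negligible N"
    and eq: "\<And>t. t \<in> {0<..} - N \<Longrightarrow> f t = g t"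
    by (rule lebesgue_ex_borel_nonneg[OF assms(3) nonneg]) (assumption, rule that)
  have g_int: "set_integrable lebesgue {0<..} (\<lambda>t. g t powr p)"
    by (rule absolutely_integrable_spike[OF assms(4) N]) (simp add: eq)
  note borel = assms(1) g g_int
  \<comment> \<open>Integration over \<open>t\<close> absorbs the set \<open>N\<close>, so the
    means, and below the remainders, agree at every \<open>x\<close> and not just almost
    everywhere.\<close>
  have mean: "hardy_mean f = hardy_mean g"
    unfolding hardy_mean_def fun_eq_iff
    by (intro allI arg_cong2[where f = "(*)"] refl set_lebesgue_integral_spike[OF N] eq) auto
  have integrand: "hardy_remainder_integrand p f x t = hardy_remainder_integrand p g x t"
    if "t \<in> {0<..<x} - N" for x t
    using eq[of t] that unfolding hardy_remainder_integrand_def mean by simp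
  have remainder: "hardy_remainder p f = hardy_remainder p g"
    unfolding hardy_remainder_def fun_eq_iff
    by (intro allI arg_cong2[where f = "(*)"] refl set_lebesgue_integral_spike[OF N] integrand)
  have "set_integrable lebesgue {0<..<x} f" if "0 < x" for x
    by (rule absolutely_integrable_spike[OF set_integrable_initial[OF borel that] N]) (simp add: eq)
  moreover have "set_integrable lebesgue {0<..<x} (hardy_remainder_integrand p f x)" if "0 < x" for x
    by (rule absolutely_integrable_spike[OF hardy_remainder_bound(1)[OF borel that] N]) (rule integrand)
  moreover have "(LINT x:{0<..}|lebesgue. f x powr p) = (LINT x:{0<..}|lebesgue. g x powr p)"
    by (rule set_lebesgue_integral_spike[OF N]) (simp add: eq)
  ultimately show ?thesis
    using hardy_inequality_borel[OF borel] unfolding mean remainder by simp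
qed

end
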